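(* Let $a\ge 3$ and $m\ge 1$ be integers, let $J=(x_1^{am},x_2^{am})(x_1^m,x_2^m)\subset K[x_1,x_2]$ and $E=(x_1^a,x_2^a)(x_1,x_2)\subset K[x_1,x_2]$. Then for every integer $k\ge 1$, $$\mu(J^k)=\mu(E^k)=\begin{cases}(k+1)^2, & \text{if } k\le a-1;\\ (a+1)k+1, & \text{if } k\ge a-1.\end{cases}$$
   Context: $K$ is a field and $\mu(L)$ denotes the minimal number of generators of a graded ideal $L$. *)

theory Defs
  imports
    "HOL-Algebra.Algebraic_Closure_Type"
    "HOL-Algebra.Ideal_Product"
    "HOL-Library.Poly_Mapping"
    "HOL-Library.Numeral_Type"
begin

text \<open>
  \<open>K[x\<^sub>1, x\<^sub>2]\<close> as the monoid algebra of the exponent vectors over the two-element index type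
  \<open>2\<close>. The multiplication that \<open>HOL-Library.Poly_Mapping\<close> puts on finitely supported functions is
  convolution, i.e. multiplication of polynomials. In the index type, \<open>2 = 0 \<noteq> 1\<close>, so \<open>poly2_var 1\<close> and
  \<open>poly2_var 2\<close> are the two distinct variables.
\<close>

type_synonym 'k poly2 = "(2 \<Rightarrow>\<^sub>0 nat) \<Rightarrow>\<^sub>0 'k"

definition poly2_var :: "2 \<Rightarrow> 'k::field poly2" where
  "poly2_var i = Poly_Mapping.single (Poly_Mapping.single i 1) 1"

abbreviation poly2_ring :: "'k::field poly2 ring" (\<open>\<P>\<close>) where
  "\<P> \<equiv> ring_of_type_algebra"

text \<open>
  The minimal number of generators. The value is meaningful only for finitely generated ideals,
  which includes every ideal of \<open>\<P>\<close>.
\<close>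

definition min_num_gens :: "('a, 'b) ring_scheme \<Rightarrow> 'a set \<Rightarrow> nat" (\<open>\<mu>\<index>\<close>) where
  "\<mu>\<^bsub>R\<^esub> L = (LEAST n. \<exists>G \<subseteq> carrier R. finite G \<and> card G = n \<and> Idl\<^bsub>R\<^esub> G = L)"

end

theory Submission
  imports Defs
begin

text \<open>
  Both powers are generated by monomials of a single degree, namely
  \<open>x\<^sub>1\<^bsup>mt\<^esup> x\<^sub>2\<^bsup>m((a+1)k-t)\<^esup>\<close> for \<open>t = ai + j\<close> with \<open>0 \<le> i, j \<le> k\<close> (where \<open>m = 1\<close> for \<open>E\<close>).
  Distinct monomials of equal degree form a minimal generating set, since the lowest degree
  component of the ideal has them as a basis and is spanned by the lowest degree components of any
  generating set. It remains to count the numbers \<open>ai + j\<close>: for \<open>k < a\<close> these are the \<open>(k+1)\<^sup>2\<close>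
  two-digit expansions with digits at most \<open>k\<close>, and for \<open>k \<ge> a - 1\<close> they fill the whole interval
  \<open>{0..(a+1)k}\<close>.
\<close>

section \<open>Ideals and products of ideals in terms of generators\<close>

lemma ideal_ring_of_type_algebra_iff:
  fixes I :: "'a::comm_ring_1 set"
  shows "ideal I ring_of_type_algebra \<longleftrightarrow>
    0 \<in> I \<and> (\<forall>x\<in>I. \<forall>y\<in>I. x + y \<in> I) \<and> (\<forall>r. \<forall>x\<in>I. r * x \<in> I)"
proof
  assume "ideal I ring_of_type_algebra"
  then interpret ideal I ring_of_type_algebra .
  show "0 \<in> I \<and> (\<forall>x\<in>I. \<forall>y\<in>I. x + y \<in> I) \<and> (\<forall>r. \<forall>x\<in>I. r * x \<in> I)"
    using additive_subgroup.zero_closed[OF is_additive_subgroup]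
      additive_subgroup.a_closed[OF is_additive_subgroup] I_l_closed
    by (auto simp: ring_of_type_algebra_def)
next
  interpret cring "ring_of_type_algebra :: 'a ring" by (rule cring_from_type_algebra)
  assume *: "0 \<in> I \<and> (\<forall>x\<in>I. \<forall>y\<in>I. x + y \<in> I) \<and> (\<forall>r. \<forall>x\<in>I. r * x \<in> I)"
  show "ideal I ring_of_type_algebra"
  proof (rule idealI)
    show "subgroup I (add_monoid (ring_of_type_algebra :: 'a ring))"
    proof (rule add.subgroupI)
      fix x assume x: "x \<in> I"
      \<comment> \<open>Closure under negation comes for free: it is multiplication by the ring
        element -1.\<close>
      have "\<ominus>\<^bsub>ring_of_type_algebra\<^esub> x = - 1 * x"
        by (rule minus_equality) (simp_all add: ring_of_type_algebra_def)
      with x * show "\<ominus>\<^bsub>ring_of_type_algebra\<^esub> x \<in> I" by metis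
    qed (use * in \<open>auto simp: ring_of_type_algebra_def\<close>)
    fix x r assume "x \<in> I" "r \<in> carrier (ring_of_type_algebra :: 'a ring)"
    with * show "r \<otimes>\<^bsub>ring_of_type_algebra\<^esub> x \<in> I" "x \<otimes>\<^bsub>ring_of_type_algebra\<^esub> r \<in> I"
      by (simp_all add: ring_of_type_algebra_def mult.commute[of x r])
  qed (rule local.ring_axioms)
qed

text \<open>The inclusion from left to right extends from generators to ideals one factor at a time.
  The elements that multiply \<open>B\<close> into the ideal of \<open>?P\<close> form an ideal
  containing \<open>A\<close>, hence all of \<open>Idl A\<close>; the elements that multiply
  \<open>Idl A\<close> into it then form an ideal containing \<open>B\<close>.\<close>

lemma genideal_mult_genideal:
  fixes A B :: "'a::comm_ring_1 set"
  defines "R \<equiv> (ring_of_type_algebra :: 'a ring)"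
  shows "(Idl\<^bsub>R\<^esub> A) \<cdot>\<^bsub>R\<^esub> (Idl\<^bsub>R\<^esub> B) = Idl\<^bsub>R\<^esub> ((\<lambda>(x, y). x * y) ` (A \<times> B))"
    (is "_ = Idl\<^bsub>R\<^esub> ?P")
proof -
  interpret cring R unfolding R_def by (rule cring_from_type_algebra)
  have carrier [simp]: "carrier R = UNIV" and mult [simp]: "x \<otimes>\<^bsub>R\<^esub> y = x * y" for x y
    by (simp_all add: R_def ring_of_type_algebra_def)
  have idl: "ideal (Idl\<^bsub>R\<^esub> Y) R" for Y by (rule genideal_ideal) simp
  have sub: "Y \<subseteq> Idl\<^bsub>R\<^esub> Y" for Y by (rule genideal_self) simp
  note iff = ideal_ring_of_type_algebra_iff[where 'a = 'a, folded R_def]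
  have P: "0 \<in> Idl\<^bsub>R\<^esub> ?P" "\<And>x y. x \<in> Idl\<^bsub>R\<^esub> ?P \<Longrightarrow> y \<in> Idl\<^bsub>R\<^esub> ?P \<Longrightarrow> x + y \<in> Idl\<^bsub>R\<^esub> ?P"
    "\<And>r x. x \<in> Idl\<^bsub>R\<^esub> ?P \<Longrightarrow> r * x \<in> Idl\<^bsub>R\<^esub> ?P"
    using idl[of ?P] unfolding iff by simp_all
  \<comment> \<open>This is the colon ideal of \<open>Idl ?P\<close> by \<open>Y\<close>, used below
    with \<open>Y = B\<close> and with \<open>Y = Idl A\<close>.\<close>
  have colon: "ideal {x. \<forall>y\<in>Y. x * y \<in> Idl\<^bsub>R\<^esub> ?P} R" for Y
    unfolding iff using P by (auto simp: distrib_right mult.assoc)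
  have A: "Idl\<^bsub>R\<^esub> A \<subseteq> {x. \<forall>y\<in>B. x * y \<in> Idl\<^bsub>R\<^esub> ?P}"
    by (rule genideal_minimal[OF colon]) (use sub[of ?P] in auto)
  have B: "Idl\<^bsub>R\<^esub> B \<subseteq> {y. \<forall>x\<in>Idl\<^bsub>R\<^esub> A. y * x \<in> Idl\<^bsub>R\<^esub> ?P}"
  proof (rule genideal_minimal[OF colon], rule subsetI, rule CollectI, rule ballI)
    fix y x assume "y \<in> B" "x \<in> Idl\<^bsub>R\<^esub> A"
    with A have "x * y \<in> Idl\<^bsub>R\<^esub> ?P" by blast
    then show "y * x \<in> Idl\<^bsub>R\<^esub> ?P" by (simp only: mult.commute[of y x])
  qed
  have *: "x * y \<in> Idl\<^bsub>R\<^esub> ?P" if "x \<in> Idl\<^bsub>R\<^esub> A" "y \<in> Idl\<^bsub>R\<^esub> B" for x y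
    using B that by (simp add: subset_iff mult.commute[of x y])
  show ?thesis
  proof
    show "(Idl\<^bsub>R\<^esub> A) \<cdot>\<^bsub>R\<^esub> (Idl\<^bsub>R\<^esub> B) \<subseteq> Idl\<^bsub>R\<^esub> ?P"
    proof
      fix s assume "s \<in> (Idl\<^bsub>R\<^esub> A) \<cdot>\<^bsub>R\<^esub> (Idl\<^bsub>R\<^esub> B)"
      then show "s \<in> Idl\<^bsub>R\<^esub> ?P"
        by induction (use * P in \<open>auto simp: R_def ring_of_type_algebra_def\<close>)
    qed
    have "x * y \<in> (Idl\<^bsub>R\<^esub> A) \<cdot>\<^bsub>R\<^esub> (Idl\<^bsub>R\<^esub> B)" if "x \<in> A" "y \<in> B" for x y
      using ideal_prod.prod[of x "Idl\<^bsub>R\<^esub> A" y "Idl\<^bsub>R\<^esub> B" R] sub that by auto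
    then show "Idl\<^bsub>R\<^esub> ?P \<subseteq> (Idl\<^bsub>R\<^esub> A) \<cdot>\<^bsub>R\<^esub> (Idl\<^bsub>R\<^esub> B)"
      by (intro genideal_minimal ideal_prod_is_ideal idl) auto
  qed
qed

section \<open>Minimal generators of an ideal generated by monomials of one degree\<close>

text \<open>Scalars act as constant polynomials, which makes span and independence from linear
  algebra available in the polynomial ring.\<close>

lemma vector_space_poly_mapping:
  "vector_space (\<lambda>c (p :: 'e::comm_monoid_add \<Rightarrow>\<^sub>0 'k::field). Poly_Mapping.single 0 c * p)"
  by unfold_locales (simp_all add: algebra_simps single_add mult_single flip: mult.assoc)

lemma lookup_const_mult:
  fixes p :: "'e::comm_monoid_add \<Rightarrow>\<^sub>0 'k::field"
  shows "Poly_Mapping.lookup (Poly_Mapping.single 0 c * p) e = c * Poly_Mapping.lookup p e"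
proof -
  have "(c when 0 = l) * x = (c * x when l = 0)" for l :: 'e and x
    by (auto simp: when_def)
  then show ?thesis by (simp only: lookup_mult lookup_single) simp
qed

text \<open>After the constant term of \<open>p\<close> is split off, all exponents of the remainder
  \<open>q\<close> have positive degree. Since no exponent of \<open>f\<close> lies below the degree
  of \<open>s\<close>, the product \<open>q * f\<close> has no term at \<open>s\<close>.\<close>

lemma lookup_mult_lowest:
  fixes p f :: "'e::comm_monoid_add \<Rightarrow>\<^sub>0 'k::field" and deg :: "'e \<Rightarrow> nat"
  assumes deg_add: "\<And>x y. deg (x + y) = deg x + deg y" and deg_zero: "\<And>x. deg x = 0 \<Longrightarrow> x = 0"
    and f: "\<And>e. e \<in> Poly_Mapping.keys f \<Longrightarrow> deg e \<ge> deg s"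
  shows "Poly_Mapping.lookup (p * f) s = Poly_Mapping.lookup p 0 * Poly_Mapping.lookup f s"
proof -
  define q where "q = p - Poly_Mapping.single 0 (Poly_Mapping.lookup p 0)"
  have q0: "0 \<notin> Poly_Mapping.keys q"
    by (simp add: q_def in_keys_iff lookup_minus)
  have "s \<notin> Poly_Mapping.keys (q * f)"
  proof
    assume "s \<in> Poly_Mapping.keys (q * f)"
    then obtain u v where "u \<in> Poly_Mapping.keys q" "v \<in> Poly_Mapping.keys f" "s = u + v"
      using keys_mult[of q f] by blast
    then show False
      using f[of v] deg_add[of u v] deg_zero[of u] q0 by auto
  qed
  moreover have "p * f = q * f + Poly_Mapping.single 0 (Poly_Mapping.lookup p 0) * f"
    by (simp add: q_def algebra_simps)
  ultimately show ?thesis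
    by (simp add: lookup_add lookup_const_mult not_in_keys_iff_lookup_eq_zero)
qed

lemma independent_monomials:
  "\<not> module.dependent (\<lambda>c (p :: 'e::comm_monoid_add \<Rightarrow>\<^sub>0 'k::field). Poly_Mapping.single 0 c * p)
     ((\<lambda>s. Poly_Mapping.single s 1) ` S)"
proof -
  interpret vector_space "\<lambda>c (p :: 'e \<Rightarrow>\<^sub>0 'k). Poly_Mapping.single 0 c * p"
    by (rule vector_space_poly_mapping)
  show ?thesis
    unfolding independent_explicit_module
  proof (intro allI impI)
    fix t u and v :: "'e \<Rightarrow>\<^sub>0 'k"
    assume t: "finite t" "t \<subseteq> (\<lambda>s. Poly_Mapping.single s 1) ` S"
      and sum: "(\<Sum>v\<in>t. Poly_Mapping.single 0 (u v) * v) = 0" and v: "v \<in> t"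
    from t v obtain s where s: "v = Poly_Mapping.single s 1" by auto
    have "0 = Poly_Mapping.lookup (\<Sum>w\<in>t. Poly_Mapping.single 0 (u w) * w) s"
      by (simp add: sum)
    also have "\<dots> = (\<Sum>w\<in>t. u w * Poly_Mapping.lookup w s)"
      by (simp add: lookup_sum lookup_const_mult)
    \<comment> \<open>All elements of \<open>t\<close> are monomials, so \<open>v\<close> alone has
      a nonzero coefficient at \<open>s\<close>.\<close>
    also have "\<dots> = (\<Sum>w\<in>t. if w = v then u v else 0)"
      using t(2) by (intro sum.cong) (auto simp: s lookup_single when_def dest!: subsetD split: if_splits)
    finally show "u v = 0" using t(1) v by simp
  qed
qed

text \<open>On the ideal, taking the component of the lowest degree \<open>d\<close> turns
  multiplication by a polynomial into multiplication by its constant term. The components of any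
  generating set therefore span the monomials of \<open>S\<close> over the field, and these are
  independent.\<close>

lemma min_num_gens_equigenerated:
  fixes S :: "'e::comm_monoid_add set" and deg :: "'e \<Rightarrow> nat"
  defines "R \<equiv> (ring_of_type_algebra :: ('e \<Rightarrow>\<^sub>0 'k::field) ring)"
  assumes deg_add: "\<And>x y. deg (x + y) = deg x + deg y" and deg_zero: "\<And>x. deg x = 0 \<Longrightarrow> x = 0"
    and S: "finite S" "\<And>s. s \<in> S \<Longrightarrow> deg s = d"
  shows "\<mu>\<^bsub>R\<^esub> (Idl\<^bsub>R\<^esub> ((\<lambda>s. Poly_Mapping.single s 1) ` S)) = card S"
proof -
  define B where "B = (\<lambda>s. Poly_Mapping.single s 1 :: 'e \<Rightarrow>\<^sub>0 'k) ` S"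
  interpret V: vector_space "\<lambda>c (p :: 'e \<Rightarrow>\<^sub>0 'k). Poly_Mapping.single 0 c * p"
    by (rule vector_space_poly_mapping)
  interpret cring R unfolding R_def by (rule cring_from_type_algebra)
  have carrier [simp]: "carrier R = UNIV"
    by (simp add: R_def ring_of_type_algebra_def)
  note iff = ideal_ring_of_type_algebra_iff[where 'a = "'e \<Rightarrow>\<^sub>0 'k", folded R_def]
  have sub: "Y \<subseteq> Idl\<^bsub>R\<^esub> Y" for Y by (rule genideal_self) simp
  have inj: "inj_on (\<lambda>s. Poly_Mapping.single s 1 :: 'e \<Rightarrow>\<^sub>0 'k) S"
    by (rule inj_onI) (metis keys_single singleton_inject zero_neq_one)
  then have card_B: "card B = card S"
    by (simp add: B_def card_image)
  \<comment> \<open>The polynomials without terms of degree below \<open>d\<close> form an ideal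
    containing \<open>B\<close>, so every generating set of \<open>Idl B\<close> lies in it.\<close>
  define H :: "('e \<Rightarrow>\<^sub>0 'k) set" where "H = {f. \<forall>e\<in>Poly_Mapping.keys f. d \<le> deg e}"
  have H: "0 \<in> H" "\<And>f g. f \<in> H \<Longrightarrow> g \<in> H \<Longrightarrow> f + g \<in> H" "\<And>p f. f \<in> H \<Longrightarrow> p * f \<in> H"
  proof -
    show "0 \<in> H" by (simp add: H_def)
    show "f + g \<in> H" if "f \<in> H" "g \<in> H" for f g
      using that keys_add[of f g] by (auto simp: H_def)
    show "p * f \<in> H" if "f \<in> H" for p f
      using that keys_mult[of p f] deg_add by (fastforce simp: H_def intro: trans_le_add2)
  qed
  have B_H: "B \<subseteq> H" using S by (auto simp: B_def H_def)
  \<comment> \<open>\<open>T\<close> keeps only the terms with exponent in \<open>S\<close>; on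
    \<open>Idl B\<close> this is the component of degree \<open>d\<close>.\<close>
  define T :: "('e \<Rightarrow>\<^sub>0 'k) \<Rightarrow> ('e \<Rightarrow>\<^sub>0 'k)"
    where "T f = (\<Sum>s\<in>S. Poly_Mapping.single s (Poly_Mapping.lookup f s))" for f
  have T_add: "T (f + g) = T f + T g" for f g
    by (simp add: T_def lookup_add single_add sum.distrib)
  have T_mult: "T (p * f) = Poly_Mapping.single 0 (Poly_Mapping.lookup p 0) * T f"
    if "f \<in> H" for p f
    using that S lookup_mult_lowest[of deg, OF deg_add deg_zero, of f _ p]
    by (auto simp: T_def H_def sum_distrib_left mult_single intro!: sum.cong)
  have T_single: "T (Poly_Mapping.single s 1) = Poly_Mapping.single s 1" if "s \<in> S" for s
  proof -
    have "T (Poly_Mapping.single s 1) = (\<Sum>t\<in>S. if t = s then Poly_Mapping.single s 1 else 0)"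
      unfolding T_def by (intro sum.cong) (auto simp: lookup_single when_def)
    then show ?thesis using that S by simp
  qed
  have "card S \<le> card G" if "finite G" and G: "Idl\<^bsub>R\<^esub> G = Idl\<^bsub>R\<^esub> B" for G
  proof -
    have "ideal H R" unfolding iff using H by blast
    then have "Idl\<^bsub>R\<^esub> B \<subseteq> H" using B_H by (rule genideal_minimal)
    then have G_H: "G \<subseteq> H" using G sub by blast
    \<comment> \<open>By \<open>T_mult\<close> a mere vector space condition on \<open>T f\<close>
      survives multiplication by arbitrary polynomials, so minimality of \<open>Idl G\<close>
      applies to it.\<close>
    have "ideal {f \<in> H. T f \<in> V.span (T ` G)} R"
      unfolding iff using H V.span_zero
      by (auto simp: T_add T_mult intro: V.span_add V.span_scale) (simp add: T_def V.span_zero)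
    then have "Idl\<^bsub>R\<^esub> G \<subseteq> {f \<in> H. T f \<in> V.span (T ` G)}"
      by (rule genideal_minimal) (use G_H in \<open>auto intro: V.span_base\<close>)
    moreover have "B \<subseteq> Idl\<^bsub>R\<^esub> G" using sub G by simp
    ultimately have "B \<subseteq> V.span (T ` G)"
      using T_single by (force simp: B_def)
    \<comment> \<open>Steinitz exchange: an independent set in the span of a finite set is no larger
      than that set.\<close>
    then have "card B \<le> card (T ` G)"
      using V.independent_span_bound[of "T ` G" B] independent_monomials that
      unfolding B_def by blast
    also have "\<dots> \<le> card G" using that by (intro card_image_le)
    finally show ?thesis by (simp add: card_B)
  qed
  \<comment> \<open>The lower bound is attained by \<open>B\<close> itself.\<close>
  then show ?thesis
    unfolding min_num_gens_def B_def[symmetric]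
    by (intro Least_equality) (use card_B S in \<open>auto simp: B_def\<close>)
qed

section \<open>Counting the numbers \<open>a * i + j\<close> with \<open>i\<close> and
  \<open>j\<close> at most \<open>k\<close>\<close>

text \<open>Up to \<open>a * k\<close>, division by \<open>a\<close> gives the digits: the quotient
  is at most \<open>k\<close>, and the remainder is at most \<open>a - 1\<close>, hence at most
  \<open>k\<close>. Above \<open>a * k\<close>, the choice \<open>i = k\<close> leaves a second
  digit of at most \<open>k\<close>.\<close>

lemma digit_sums_eq_atMost:
  fixes a k :: nat
  assumes "a \<ge> 1" "k \<ge> a - 1"
  shows "(\<lambda>(i, j). a * i + j) ` ({..k} \<times> {..k}) = {..(a + 1) * k}"
proof
  have "a * i + j \<le> (a + 1) * k" if "i \<le> k" "j \<le> k" for i j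
    using that by (simp add: add_mono add.commute[of k])
  then show "(\<lambda>(i, j). a * i + j) ` ({..k} \<times> {..k}) \<subseteq> {..(a + 1) * k}" by auto
  show "{..(a + 1) * k} \<subseteq> (\<lambda>(i, j). a * i + j) ` ({..k} \<times> {..k})"
  proof
    fix t assume t: "t \<in> {..(a + 1) * k}"
    show "t \<in> (\<lambda>(i, j). a * i + j) ` ({..k} \<times> {..k})"
    proof (cases "t \<le> a * k")
      case True
      have "t div a \<le> k"
        using True assms(1) by (metis div_le_mono nonzero_mult_div_cancel_left not_one_le_zero)
      moreover have "t mod a \<le> k"
        using assms mod_less_divisor[of a t] by linarith
      ultimately show ?thesis by (intro image_eqI[of _ _ "(t div a, t mod a)"]) auto
    next
      case False
      with t show ?thesis by (intro image_eqI[of _ _ "(k, t - a * k)"]) auto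
    qed
  qed
qed

text \<open>Since \<open>j\<close> is at most \<open>k < a\<close>, it is the remainder modulo
  \<open>a\<close>, and division by \<open>a\<close> recovers the pair.\<close>

lemma card_digit_sums:
  fixes a k :: nat
  assumes "k < a"
  shows "card ((\<lambda>(i, j). a * i + j) ` ({..k} \<times> {..k})) = (k + 1)\<^sup>2"
proof -
  have "inj_on (\<lambda>(i, j). a * i + j) ({..k} \<times> {..k})"
  proof (rule inj_onI, clarsimp)
    fix i j i' j' assume *: "j \<le> k" "j' \<le> k" "a * i + j = a * i' + j'"
    have "(a * i + j) div a = i" "(a * i' + j') div a = i'"
      using *(1,2) assms by simp_all
    then have "i = i'" using *(3) by simp
    with * show "i = i' \<and> j = j'" by simp
  qed
  then show ?thesis
    by (simp add: card_image power2_eq_square)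
qed

section \<open>Monomials in two variables and powers of the ideal\<close>

definition xy :: "nat \<Rightarrow> nat \<Rightarrow> 2 \<Rightarrow>\<^sub>0 nat" where
  "xy u v = Poly_Mapping.single 1 u + Poly_Mapping.single 2 v"

lemma xy_add: "xy u v + xy u' v' = xy (u + u') (v + v')"
  by (simp add: xy_def single_add ac_simps)

lemma lookup_xy: "Poly_Mapping.lookup (xy u v) 1 = u" "Poly_Mapping.lookup (xy u v) 2 = v"
  by (simp_all add: xy_def lookup_add lookup_single)

lemma exponent_eq_zeroI:
  fixes e :: "2 \<Rightarrow>\<^sub>0 nat"
  assumes "Poly_Mapping.lookup e 1 + Poly_Mapping.lookup e 2 = 0"
  shows "e = 0"
proof (rule poly_mapping_eqI)
  fix i :: 2
  \<comment> \<open>The case analysis on the index type yields the representatives 0 and 1, whereas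
    the second variable is written with index 2.\<close>
  have two: "(0 :: 2) = 2" by simp
  show "Poly_Mapping.lookup e i = Poly_Mapping.lookup 0 i"
  proof (cases i)
    case (of_int z)
    then have "z = 0 \<or> z = 1" by auto
    moreover have "Poly_Mapping.lookup e (0 :: 2) = 0"
      using assms by (metis add_is_0 two)
    ultimately show ?thesis using assms of_int by auto
  qed
qed

lemma poly2_var_power: "(poly2_var i :: 'k::field poly2) ^ n
    = Poly_Mapping.single (Poly_Mapping.single i n) 1"
  by (induction n) (simp_all add: poly2_var_def mult_single single_add[symmetric])

text \<open>A product of \<open>k\<close> generators of \<open>J\<close> chooses \<open>k\<close>
  times from each of the two factors: \<open>i\<close> counts the choices of the power of the first
  variable in the first factor, \<open>j\<close> those in the second.\<close>

lemma genideal_power: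
  fixes a m k :: nat and J :: "'k::field poly2 set"
  assumes J: "J = (Idl\<^bsub>\<P>\<^esub> {poly2_var 1 ^ (a * m), poly2_var 2 ^ (a * m)})
      \<cdot>\<^bsub>\<P>\<^esub> (Idl\<^bsub>\<P>\<^esub> {poly2_var 1 ^ m, poly2_var 2 ^ m})"
  shows "J [^]\<^bsub>ideals_set \<P>\<^esub> k = Idl\<^bsub>\<P>\<^esub> ((\<lambda>s. Poly_Mapping.single s 1) `
    (\<lambda>(i, j). xy (m * (a * i + j)) (m * (a * (k - i) + (k - j)))) ` ({..k} \<times> {..k}))"
proof -
  interpret cring "\<P> :: 'k poly2 ring" by (rule cring_from_type_algebra)
  interpret ideals: comm_monoid "ideals_set \<P> :: 'k poly2 set ring"
    by (rule ideals_set_is_comm_monoid)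
  define M :: "(2 \<Rightarrow>\<^sub>0 nat) \<Rightarrow> 'k poly2" where "M = (\<lambda>s. Poly_Mapping.single s 1)"
  define e where "e k = (\<lambda>(i, j). xy (m * (a * i + j)) (m * (a * (k - i) + (k - j))))" for k
  have M_mult: "M s * M t = M (s + t)" for s t by (simp add: M_def mult_single)
  have J': "J = Idl\<^bsub>\<P>\<^esub> (M ` e 1 ` ({..1} \<times> {..1}))"
  proof -
    have atMost_1: "{..1::nat} = {0, 1}" by auto
    have var: "poly2_var 1 ^ n = M (xy n 0)" "poly2_var 2 ^ n = M (xy 0 n)" for n
      by (simp_all add: poly2_var_power M_def xy_def)
    have "(\<lambda>(x, y). x * y) ` ({M (xy (a * m) 0), M (xy 0 (a * m))} \<times> {M (xy m 0), M (xy 0 m)})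
        = M ` e 1 ` ({..1} \<times> {..1})"
      unfolding atMost_1 by (simp add: e_def M_mult xy_add Sigma_def algebra_simps insert_commute)
    then show ?thesis
      unfolding J genideal_mult_genideal var by simp
  qed
  have "J [^]\<^bsub>ideals_set \<P>\<^esub> k = Idl\<^bsub>\<P>\<^esub> (M ` e k ` ({..k} \<times> {..k}))"
  proof (induction k)
    case 0
    have "M (e 0 (0, 0)) = \<one>\<^bsub>\<P>\<^esub>"
      by (simp add: M_def e_def xy_def ring_of_type_algebra_def)
    then show ?case using genideal_one by (simp add: ideals_set_def)
  next
    case (Suc k)
    have step: "e k p + e 1 q = e (Suc k) (fst p + fst q, snd p + snd q)"
      if pq: "p \<in> {..k} \<times> {..k}" "q \<in> {..1} \<times> {..1}" for p q
    proof -
      obtain i j i' j' where ij: "p = (i, j)" "q = (i', j')" by (metis surj_pair)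
      \<comment> \<open>The bounds on the digits ensure that none of these natural number
        subtractions truncates.\<close>
      have "Suc k - (i + i') = (k - i) + (1 - i')" "Suc k - (j + j') = (k - j) + (1 - j')"
        using pq by (auto simp: ij)
      then show ?thesis
        by (simp only: ij e_def xy_add prod.case fst_conv snd_conv) (simp add: distrib_left ac_simps)
    qed
    have "(\<lambda>(x, y). x * y) ` ((M ` e k ` ({..k} \<times> {..k})) \<times> (M ` e 1 ` ({..1} \<times> {..1})))
        = M ` e (Suc k) ` ({..Suc k} \<times> {..Suc k})" (is "?L = ?R")
    proof
      show "?L \<subseteq> ?R"
      proof
        fix z assume "z \<in> ?L"
        then obtain p q where pq: "p \<in> {..k} \<times> {..k}" "q \<in> {..1} \<times> {..1}"
          and z: "z = M (e k p) * M (e 1 q)" by (elim imageE SigmaE) auto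
        have "(fst p + fst q, snd p + snd q) \<in> {..Suc k} \<times> {..Suc k}"
          using pq by auto
        then show "z \<in> ?R" unfolding z M_mult step[OF pq] by (intro imageI)
      qed
      show "?R \<subseteq> ?L"
      proof
        fix z assume "z \<in> ?R"
        then obtain i j where ij: "i \<le> Suc k" "j \<le> Suc k" and z: "z = M (e (Suc k) (i, j))"
          by auto
        \<comment> \<open>Each digit goes into the \<open>k\<close>-th power as far as possible; an
          excess of at most 1 is left for the last factor \<open>J\<close>.\<close>
        define p where "p = (min i k, min j k)"
        define q where "q = (i - min i k, j - min j k)"
        have pq: "p \<in> {..k} \<times> {..k}" "q \<in> {..1} \<times> {..1}"
          using ij by (auto simp: p_def q_def)
        have "(i, j) = (fst p + fst q, snd p + snd q)" by (simp add: p_def q_def)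
        then have "z = (\<lambda>(x, y). x * y) (M (e k p), M (e 1 q))"
          by (simp only: z prod.case M_mult step[OF pq])
        then show "z \<in> ?L" using pq by (simp only:) (intro imageI SigmaI)
      qed
    qed
    then have "(Idl\<^bsub>\<P>\<^esub> (M ` e k ` ({..k} \<times> {..k}))) \<cdot>\<^bsub>\<P>\<^esub> J
        = Idl\<^bsub>\<P>\<^esub> (M ` e (Suc k) ` ({..Suc k} \<times> {..Suc k}))"
      by (simp only: J' genideal_mult_genideal)
    then show ?case by (simp add: Suc) (simp add: ideals_set_def)
  qed
  then show ?thesis by (simp add: M_def e_def)
qed

text \<open>The generators all have degree \<open>m * ((a + 1) * k)\<close>, and each is determined
  by its exponent \<open>m * t\<close> at the first variable, so only the values
  \<open>t = a * i + j\<close> need counting. The count does not depend on \<open>m\<close>, which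
  is what makes \<open>J\<close> and \<open>E\<close> agree.\<close>

lemma min_num_gens_power:
  fixes a m k :: nat and J :: "'k::field poly2 set"
  assumes "m \<ge> 1"
    and J: "J = (Idl\<^bsub>\<P>\<^esub> {poly2_var 1 ^ (a * m), poly2_var 2 ^ (a * m)})
      \<cdot>\<^bsub>\<P>\<^esub> (Idl\<^bsub>\<P>\<^esub> {poly2_var 1 ^ m, poly2_var 2 ^ m})"
  shows "\<mu>\<^bsub>\<P>\<^esub> (J [^]\<^bsub>ideals_set \<P>\<^esub> k) = card ((\<lambda>(i, j). a * i + j) ` ({..k} \<times> {..k}))"
proof -
  define S where "S = (\<lambda>(i, j). xy (m * (a * i + j)) (m * (a * (k - i) + (k - j)))) ` ({..k} \<times> {..k})"
  define deg where "deg s = Poly_Mapping.lookup s 1 + Poly_Mapping.lookup s 2" for s :: "2 \<Rightarrow>\<^sub>0 nat"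
  \<comment> \<open>The second exponent is thus a function of \<open>t = a * i + j\<close> alone,
    and its subtraction does not truncate.\<close>
  have compl: "a * (k - i) + (k - j) = (a + 1) * k - (a * i + j)" "a * i + j \<le> (a + 1) * k"
    if "i \<le> k" "j \<le> k" for i j
  proof -
    have "a * i \<le> a * k" "a * (k - i) = a * k - a * i"
      using that by (simp_all add: diff_mult_distrib2)
    then have "(a + 1) * k = (a * i + j) + (a * (k - i) + (k - j))"
      using that unfolding add_mult_distrib by linarith
    then show "a * (k - i) + (k - j) = (a + 1) * k - (a * i + j)" "a * i + j \<le> (a + 1) * k"
      by simp_all
  qed
  have S: "S = (\<lambda>t. xy (m * t) (m * ((a + 1) * k - t))) ` (\<lambda>(i, j). a * i + j) ` ({..k} \<times> {..k})"
    unfolding S_def image_image by (intro image_cong refl) (clarsimp simp only: mem_Times_iff atMost_iff prod.case fst_conv snd_conv compl)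
  have "inj_on (\<lambda>t. xy (m * t) (m * ((a + 1) * k - t))) A" for A
  proof (rule inj_onI)
    fix s t assume "xy (m * s) (m * ((a + 1) * k - s)) = xy (m * t) (m * ((a + 1) * k - t))"
    then have "m * s = m * t" by (metis lookup_xy(1))
    then show "s = t" using assms(1) by simp
  qed
  then have card_S: "card S = card ((\<lambda>(i, j). a * i + j) ` ({..k} \<times> {..k}))"
    unfolding S by (rule card_image)
  have "deg s = m * ((a + 1) * k)" if s: "s \<in> S" for s
  proof -
    from s obtain t where "t \<le> (a + 1) * k" "s = xy (m * t) (m * ((a + 1) * k - t))"
      unfolding S using compl(2) by auto
    then show ?thesis
      by (simp only: deg_def lookup_xy flip: distrib_left) simp
  qed
  then have "\<mu>\<^bsub>\<P>\<^esub> (Idl\<^bsub>\<P>\<^esub> ((\<lambda>s. Poly_Mapping.single s 1 :: 'k poly2) ` S)) = card S"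
    by (intro min_num_gens_equigenerated[where deg = deg])
      (auto simp: deg_def lookup_add S_def intro: exponent_eq_zeroI)
  then show ?thesis
    using genideal_power[OF J, of k] by (simp add: S_def[symmetric] card_S)
qed

theorem proposition1p5:
  fixes a m k :: nat
    and J E :: "'k::field poly2 set"
  assumes "a \<ge> 3" and "m \<ge> 1"
    and J: "J = (Idl\<^bsub>\<P>\<^esub> {poly2_var 1 ^ (a * m), poly2_var 2 ^ (a * m)}) \<cdot>\<^bsub>\<P>\<^esub> (Idl\<^bsub>\<P>\<^esub> {poly2_var 1 ^ m, poly2_var 2 ^ m})"
    and E: "E = (Idl\<^bsub>\<P>\<^esub> {poly2_var 1 ^ a, poly2_var 2 ^ a}) \<cdot>\<^bsub>\<P>\<^esub> (Idl\<^bsub>\<P>\<^esub> {poly2_var 1, poly2_var 2})"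
    and "k \<ge> 1"
  shows "\<mu>\<^bsub>\<P>\<^esub> (J [^]\<^bsub>ideals_set \<P>\<^esub> k) = \<mu>\<^bsub>\<P>\<^esub> (E [^]\<^bsub>ideals_set \<P>\<^esub> k)
    \<and> (k \<le> a - 1 \<longrightarrow> \<mu>\<^bsub>\<P>\<^esub> (E [^]\<^bsub>ideals_set \<P>\<^esub> k) = (k + 1)\<^sup>2)
    \<and> (k \<ge> a - 1 \<longrightarrow> \<mu>\<^bsub>\<P>\<^esub> (E [^]\<^bsub>ideals_set \<P>\<^esub> k) = (a + 1) * k + 1)"
proof -
  \<comment> \<open>\<open>E\<close> is the instance \<open>m = 1\<close> of the construction of
    \<open>J\<close>.\<close>
  have E': "E = (Idl\<^bsub>\<P>\<^esub> {poly2_var 1 ^ (a * 1), poly2_var 2 ^ (a * 1)})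
      \<cdot>\<^bsub>\<P>\<^esub> (Idl\<^bsub>\<P>\<^esub> {poly2_var 1 ^ 1, poly2_var 2 ^ 1})"
    using E by simp
  let ?T = "(\<lambda>(i, j). a * i + j) ` ({..k} \<times> {..k})"
  have "\<mu>\<^bsub>\<P>\<^esub> (J [^]\<^bsub>ideals_set \<P>\<^esub> k) = card ?T" "\<mu>\<^bsub>\<P>\<^esub> (E [^]\<^bsub>ideals_set \<P>\<^esub> k) = card ?T"
    using min_num_gens_power[OF _ E'] min_num_gens_power[OF \<open>m \<ge> 1\<close> J] by simp_all
  moreover have "card ?T = (k + 1)\<^sup>2" if "k \<le> a - 1"
    using that \<open>a \<ge> 3\<close> by (intro card_digit_sums) simp
  moreover have "card ?T = (a + 1) * k + 1" if "k \<ge> a - 1"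
    using that \<open>a \<ge> 3\<close> by (subst digit_sums_eq_atMost) simp_all
  ultimately show ?thesis by simp
qed

end
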